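(* Let $A=\{a_1,\ldots,a_k\}$ be any ordered finite set of positive integers and let $\tau=\tau_1\text{-}\tau_2\text{-}\cdots\text{-}\tau_s$ be a multi-pattern. Then $$C_\tau^A(x,y)=\sum_{j=1}^s C_{\tau_j}^A(x,y)\prod_{i=1}^{j-1}\left[\left(y\sum_{a\in A}x^a-1\right)C_{\tau_i}^A(x,y)+1\right].$$
   Context: A composition $\sigma=\sigma_1\ldots\sigma_m$ of $n$ with $m$ parts in $A$ is a sequence of $m$ elements of $A$ with sum $n$; the set of these is $C_{n;m}^A$. The empty composition ($n=m=0$) is included. An ordered set is a set whose elements are listed in increasing order. A partially ordered pattern (POP) is a word $\rho_1\ldots\rho_r$ of letters from a partially ordered alphabet (repeated letters allowed), possibly with dashes between some neighbouring letters. An occurrence of $\rho$ in $\sigma$ is a choice of positions $i_1<\cdots<i_r$ such that: $i_{p+1}=i_p+1$ whenever there is no dash between $\rho_p$ and $\rho_{p+1}$; $\sigma_{i_p}=\sigma_{i_q}$ whenever $\rho_p=\rho_q$; and $\sigma_{i_p}<\sigma_{i_q}$ whenever $\rho_p<\rho_q$. Nothing is required for incomparable letters. $\sigma$ avoids $\rho$ if it has no occurrence of $\rho$. $C_{n;m}^A(\rho)$ is the set of $\sigma\in C_{n;m}^A$ avoiding $\rho$, and $C_\rho^A(x,y)=\sum_{n,m\ge0}|C_{n;m}^A(\rho)|x^ny^m$. A consecutive pattern is a dash-free word over a totally ordered alphabet $[t]=\{1,\dots,t\}$ that contains each letter of $[t]$ at least once. A multi-pattern $\tau_1\text{-}\tau_2\text{-}\cdots\text{-}\tau_s$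 is the POP obtained from consecutive patterns $\tau_1,\dots,\tau_s$ (not necessarily distinct) by concatenating them with dashes exactly between successive blocks, where each letter of the block $\tau_i$ is incomparable with every letter of the block $\tau_j$ whenever $i\neq j$ (the blocks use disjoint copies of their alphabets, and the order inside each block is kept). *)

theory Defs
  imports "HOL-Computational_Algebra.Formal_Power_Series"
begin

definition compositions :: "nat set \<Rightarrow> nat \<Rightarrow> nat \<Rightarrow> nat list set" where
  "compositions A n m = {\<sigma>. set \<sigma> \<subseteq> A \<and> length \<sigma> = m \<and> sum_list \<sigma> = n}"

text \<open>
  A partially ordered pattern consists of its word, the set of dashed places, and the strict
  order of its alphabet. Positions are counted from 0, and p is in the set of dashes
  if there is a dash between the letters at positions p and p + 1 of the word.
\<close>

datatype 'l pop = POP (pop_word: "'l list") (pop_dashes: "nat set") (pop_less: "'l \<Rightarrow> 'l \<Rightarrow> bool")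

definition occurrence :: "'l pop \<Rightarrow> nat list \<Rightarrow> nat list \<Rightarrow> bool" where
  "occurrence \<rho> \<sigma> is \<longleftrightarrow>
     (let w = pop_word \<rho>; r = length w in
       length is = r \<and> sorted_wrt (<) is \<and> set is \<subseteq> {..<length \<sigma>} \<and>
       (\<forall>p. Suc p < r \<and> p \<notin> pop_dashes \<rho> \<longrightarrow> is ! Suc p = is ! p + 1) \<and>
       (\<forall>p<r. \<forall>q<r. w ! p = w ! q \<longrightarrow> \<sigma> ! (is ! p) = \<sigma> ! (is ! q)) \<and>
       (\<forall>p<r. \<forall>q<r. pop_less \<rho> (w ! p) (w ! q) \<longrightarrow> \<sigma> ! (is ! p) < \<sigma> ! (is ! q)))"

definition avoids :: "nat list \<Rightarrow> 'l pop \<Rightarrow> bool" where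
  "avoids \<sigma> \<rho> \<longleftrightarrow> \<not> (\<exists>is. occurrence \<rho> \<sigma> is)"

definition avoiding_compositions :: "nat set \<Rightarrow> 'l pop \<Rightarrow> nat \<Rightarrow> nat \<Rightarrow> nat list set" where
  "avoiding_compositions A \<rho> n m = {\<sigma> \<in> compositions A n m. avoids \<sigma> \<rho>}"

text \<open>
  Bivariate power series in x and y are power series in x whose coefficients
  are power series in y.
\<close>

abbreviation gf_x :: "int fps fps" where
  "gf_x \<equiv> fps_X"

abbreviation gf_y :: "int fps fps" where
  "gf_y \<equiv> fps_const fps_X"

definition comp_gf :: "nat set \<Rightarrow> 'l pop \<Rightarrow> int fps fps" where
  "comp_gf A \<rho> = Abs_fps (\<lambda>n. Abs_fps (\<lambda>m. int (card (avoiding_compositions A \<rho> n m))))"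

definition is_consecutive_pattern :: "nat list \<Rightarrow> bool" where
  "is_consecutive_pattern w \<longleftrightarrow> (\<exists>t\<ge>1. set w = {1..t})"

definition consecutive_pop :: "nat list \<Rightarrow> nat pop" where
  "consecutive_pop w = POP w {} (<)"

text \<open>
  The letter (i, a) is the copy of the letter a belonging to block i, which makes
  the alphabets of different blocks disjoint. As the blocks of a multi-pattern are nonempty,
  the dashes between successive blocks are exactly the places where the block index changes.
\<close>

definition multi_word :: "nat list list \<Rightarrow> (nat \<times> nat) list" where
  "multi_word \<tau> = concat (map (\<lambda>i. map (Pair i) (\<tau> ! i)) [0..<length \<tau>])"

definition multi_less :: "nat \<times> nat \<Rightarrow> nat \<times> nat \<Rightarrow> bool" where
  "multi_less u v \<longleftrightarrow> fst u = fst v \<and> snd u < snd v"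

lemma multi_less_strict_partial_order: "irreflp multi_less" "transp multi_less"
  by (auto simp: multi_less_def irreflp_def transp_def)

definition multi_pop :: "nat list list \<Rightarrow> (nat \<times> nat) pop" where
  "multi_pop \<tau> =
     POP (multi_word \<tau>)
         {p. Suc p < length (multi_word \<tau>) \<and> fst (multi_word \<tau> ! p) \<noteq> fst (multi_word \<tau> ! Suc p)}
         multi_less"

definition is_multi_pattern :: "nat list list \<Rightarrow> bool" where
  "is_multi_pattern \<tau> \<longleftrightarrow> \<tau> \<noteq> [] \<and> (\<forall>w\<in>set \<tau>. is_consecutive_pattern w)"

end

theory Submission imports Defs
begin

text \<open>
  A word contains \<open>\<tau>\<^sub>1-\<dots>-\<tau>\<^sub>s\<close> iff it splits as \<open>\<alpha>\<beta>\<close> with \<open>\<tau>\<^sub>1\<close> occurring in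
  \<open>\<alpha>\<close> and \<open>\<tau>\<^sub>2-\<dots>-\<tau>\<^sub>s\<close> occurring in \<open>\<beta>\<close>: letters of different blocks are incomparable, so the only
  link between the blocks is that they occur from left to right (\<open>not_avoids_multi_pop_Cons\<close>).
  Containment is inherited by longer words, so it is best to match \<open>\<tau>\<^sub>1\<close> as early as possible.
  Hence a word avoiding the multi-pattern either avoids \<open>\<tau>\<^sub>1\<close>, or its shortest prefix \<open>\<alpha>\<close>
  containing \<open>\<tau>\<^sub>1\<close> is followed by a word that avoids \<open>\<tau>\<^sub>2-\<dots>-\<tau>\<^sub>s\<close>, and every such pair arises from
  exactly one word (\<open>avoiders_multi_pop_Cons\<close>).

  Let \<open>C\<close> be the generating function of the words avoiding \<open>\<tau>\<^sub>1\<close>, \<open>D\<close> that of the possible \<open>\<alpha>\<close>, and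
  \<open>L\<close> that of the letters, which is \<open>y\<close> times the sum of \<open>x^a\<close> over \<open>A\<close>. Appending a letter to a word
  that avoids \<open>\<tau>\<^sub>1\<close> gives each nonempty word avoiding \<open>\<tau>\<^sub>1\<close> once and each possible \<open>\<alpha>\<close> once, so
  \<open>C L = (C - 1) + D\<close>, that is, \<open>D = (L - 1) C + 1\<close> (\<open>word_gf_minimal_nonmembers\<close>). The
  decomposition then reads \<open>C\<^sub>\<tau> = C + D C'\<close> with \<open>C'\<close> the generating function for
  \<open>\<tau>\<^sub>2-\<dots>-\<tau>\<^sub>s\<close> (\<open>comp_gf_multi_pop_Cons\<close>). Iterating it gives the formula: the
  \<open>j\<close>-th summand counts the words in which the greedy left-to-right matching fails first at block \<open>j\<close>.
\<close>

section \<open>Generating functions of sets of words\<close>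

definition word_gf :: "nat list set \<Rightarrow> int fps fps" where
  "word_gf X = Abs_fps (\<lambda>n. Abs_fps (\<lambda>m. int (card (X \<inter> {\<sigma>. length \<sigma> = m \<and> sum_list \<sigma> = n}))))"

lemma word_gf_nth:
  "fps_nth (fps_nth (word_gf X) n) m = int (card (X \<inter> {\<sigma>. length \<sigma> = m \<and> sum_list \<sigma> = n}))"
  by (simp add: word_gf_def)

lemma finite_slice:
  assumes "finite A" and "X \<subseteq> lists A"
  shows "finite (X \<inter> {\<sigma>. length \<sigma> = m \<and> sum_list \<sigma> = n})"
  by (rule finite_subset[OF _ finite_lists_length_eq[OF assms(1), of m]]) (use assms(2) in auto)

lemma word_gf_Un:
  assumes "finite A" and "X \<subseteq> lists A" and "Y \<subseteq> lists A" and "X \<inter> Y = {}"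
  shows "word_gf (X \<union> Y) = word_gf X + word_gf Y"
proof -
  have "card ((X \<union> Y) \<inter> S) = card (X \<inter> S) + card (Y \<inter> S)"
    if "S = {\<sigma>. length \<sigma> = m \<and> sum_list \<sigma> = n}" for S m n
    unfolding Int_Un_distrib2 that
    by (rule card_Un_disjoint) (use assms finite_slice[of A] in auto)
  then show ?thesis
    by (simp add: fps_eq_iff word_gf_nth)
qed

text \<open>
  Injectivity of concatenation says that each product word has a unique factorization. Length
  and sum are additive, so the words of given size split into products over all ways to
  distribute the size, which is the Cauchy product in both variables.
\<close>

lemma word_gf_append:
  assumes fin: "finite A" and X: "X \<subseteq> lists A" and Y: "Y \<subseteq> lists A"
    and inj: "inj_on (\<lambda>(u, v). u @ v) (X \<times> Y)"
  shows "word_gf ((\<lambda>(u, v). u @ v) ` (X \<times> Y)) = word_gf X * word_gf Y"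
proof (intro fps_ext)
  fix n m
  let ?S = "\<lambda>n m. {\<sigma> :: nat list. length \<sigma> = m \<and> sum_list \<sigma> = n}"
  let ?T = "\<lambda>(i, j). (X \<inter> ?S i j) \<times> (Y \<inter> ?S (n - i) (m - j))"
  let ?I = "{0..n} \<times> {0..m}"
  have split: "((\<lambda>(u, v). u @ v) ` (X \<times> Y)) \<inter> ?S n m = (\<lambda>(u, v). u @ v) ` (\<Union>p\<in>?I. ?T p)"
  proof (intro equalityI subsetI)
    fix s assume "s \<in> ((\<lambda>(u, v). u @ v) ` (X \<times> Y)) \<inter> ?S n m"
    then obtain u v where uv: "u \<in> X" "v \<in> Y" "s = u @ v" "length u + length v = m"
      "sum_list u + sum_list v = n"
      by auto
    have "(sum_list u, length u) \<in> ?I"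
      using uv(4,5) by simp
    moreover have "(u, v) \<in> ?T (sum_list u, length u)"
      using uv by auto
    ultimately have "(u, v) \<in> (\<Union>p\<in>?I. ?T p)"
      by (rule UN_I)
    with uv(3) show "s \<in> (\<lambda>(u, v). u @ v) ` (\<Union>p\<in>?I. ?T p)"
      by (intro image_eqI[where x = "(u, v)"]) simp_all
  qed auto
  have "card (((\<lambda>(u, v). u @ v) ` (X \<times> Y)) \<inter> ?S n m) = card (\<Union>p\<in>?I. ?T p)"
    unfolding split by (rule card_image, rule inj_on_subset[OF inj]) auto
  also have "\<dots> = (\<Sum>p\<in>?I. card (?T p))"
    by (rule card_UN_disjoint)
      (use finite_slice[OF fin X] finite_slice[OF fin Y] in \<open>auto intro!: finite_cartesian_product\<close>)
  also have "\<dots> = (\<Sum>i=0..n. \<Sum>j=0..m. card (X \<inter> ?S i j) * card (Y \<inter> ?S (n - i) (m - j)))"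
    by (simp add: sum.cartesian_product card_cartesian_product split_def)
  finally show "fps_nth (fps_nth (word_gf ((\<lambda>(u, v). u @ v) ` (X \<times> Y))) n) m
      = fps_nth (fps_nth (word_gf X * word_gf Y) n) m"
    by (simp add: word_gf_nth fps_mult_nth fps_sum_nth)
qed

lemma word_gf_Nil: "word_gf {[]} = 1"
proof (intro fps_ext)
  fix n m
  have "{[]} \<inter> {\<sigma> :: nat list. length \<sigma> = m \<and> sum_list \<sigma> = n} = (if n = 0 \<and> m = 0 then {[]} else {})"
    by auto
  then show "fps_nth (fps_nth (word_gf {[]}) n) m = fps_nth (fps_nth 1 n) m"
    by (simp add: word_gf_nth)
qed

lemma word_gf_letters:
  assumes "finite A"
  shows "word_gf ((\<lambda>a. [a]) ` A) = gf_y * (\<Sum>a\<in>A. gf_x ^ a)"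
proof (intro fps_ext)
  fix n m
  have "((\<lambda>a. [a]) ` A) \<inter> {\<sigma>. length \<sigma> = m \<and> sum_list \<sigma> = n} = (if m = 1 \<and> n \<in> A then {[n]} else {})"
    by auto
  moreover have "fps_nth (\<Sum>a\<in>A. gf_x ^ a) n = (if n \<in> A then 1 else 0)"
    using assms by (simp add: fps_sum_nth fps_X_power_nth)
  ultimately show "fps_nth (fps_nth (word_gf ((\<lambda>a. [a]) ` A)) n) m
      = fps_nth (fps_nth (gf_y * (\<Sum>a\<in>A. gf_x ^ a)) n) m"
    by (simp add: word_gf_nth)
qed

section \<open>Minimal words outside a prefix-closed set\<close>

text \<open>
  When \<open>F\<close> is prefix-closed, having only \<open>butlast \<sigma>\<close> in \<open>F\<close> already puts all proper prefixes of
  \<open>\<sigma>\<close> in \<open>F\<close>, so these are the words outside \<open>F\<close> that are minimal for the prefix order.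
\<close>

definition minimal_nonmembers :: "nat set \<Rightarrow> nat list set \<Rightarrow> nat list set" where
  "minimal_nonmembers A F = {\<sigma> \<in> lists A. \<sigma> \<noteq> [] \<and> \<sigma> \<notin> F \<and> butlast \<sigma> \<in> F}"

text \<open>
  A member of \<open>F\<close> extended by one letter either stays in \<open>F\<close> or has just left it; conversely,
  nonempty members and minimal nonmembers both lose their last letter to a member.
  Counting the extensions in these two ways gives a linear equation for the minimal nonmembers.
\<close>

lemma word_gf_minimal_nonmembers:
  assumes fin: "finite A" and F: "F \<subseteq> lists A" "[] \<in> F"
    and prefix: "\<And>u v. u @ v \<in> F \<Longrightarrow> u \<in> F"
  shows "word_gf (minimal_nonmembers A F) = (gf_y * (\<Sum>a\<in>A. gf_x ^ a) - 1) * word_gf F + 1"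
proof -
  let ?L = "(\<lambda>a. [a]) ` A" and ?M = "minimal_nonmembers A F"
  have ext: "(\<lambda>(u, v). u @ v) ` (F \<times> ?L) = (F - {[]}) \<union> ?M"
  proof (intro equalityI subsetI)
    fix s assume "s \<in> (\<lambda>(u, v). u @ v) ` (F \<times> ?L)"
    then obtain u a where "s = u @ [a]" "u \<in> F" "a \<in> A"
      by auto
    moreover from this have "u \<in> lists A"
      using F by blast
    ultimately show "s \<in> (F - {[]}) \<union> ?M"
      by (auto simp: minimal_nonmembers_def)
  next
    fix s assume s: "s \<in> (F - {[]}) \<union> ?M"
    then have "s \<noteq> []" "s \<in> lists A"
      using F by (auto simp: minimal_nonmembers_def)
    moreover have "butlast s \<in> F"
      using s prefix[of "butlast s" "[last s]"] by (auto simp: minimal_nonmembers_def)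
    ultimately show "s \<in> (\<lambda>(u, v). u @ v) ` (F \<times> ?L)"
      by (intro image_eqI[where x = "(butlast s, [last s])"]) auto
  qed
  have "word_gf F * word_gf ?L = word_gf (F - {[]}) + word_gf ?M"
  proof -
    have "word_gf F * word_gf ?L = word_gf ((\<lambda>(u, v). u @ v) ` (F \<times> ?L))"
      by (rule word_gf_append[OF fin, symmetric]) (use F in \<open>auto simp: inj_on_def\<close>)
    also have "\<dots> = word_gf (F - {[]}) + word_gf ?M"
      unfolding ext by (rule word_gf_Un[OF fin]) (use F in \<open>auto simp: minimal_nonmembers_def\<close>)
    finally show ?thesis .
  qed
  moreover have "word_gf F = 1 + word_gf (F - {[]})"
  proof -
    have "F = {[]} \<union> (F - {[]})"
      using F by auto
    then have "word_gf F = word_gf ({[]} \<union> (F - {[]}))"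
      by simp
    also have "\<dots> = word_gf {[]} + word_gf (F - {[]})"
      by (rule word_gf_Un[OF fin]) (use F in auto)
    finally show ?thesis
      by (simp add: word_gf_Nil)
  qed
  ultimately show ?thesis
    by (simp add: word_gf_letters[OF fin] algebra_simps)
qed

text \<open>
  If \<open>\<alpha>\<close> were longer than \<open>\<gamma>\<close>, then \<open>\<gamma>\<close> would be a prefix of \<open>butlast \<alpha>\<close> and hence in \<open>F\<close>. This is
  the minimality of \<open>\<alpha>\<close> among the prefixes of a word that lie outside \<open>F\<close>; it yields both unique
  factorization and the correctness of matching the first block greedily.
\<close>

lemma minimal_nonmember_length_le:
  assumes \<alpha>: "\<alpha> \<in> minimal_nonmembers A F" and "\<gamma> \<notin> F"
    and eq: "\<alpha> @ \<beta> = \<gamma> @ \<delta>"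
    and prefix: "\<And>u v. u @ v \<in> F \<Longrightarrow> u \<in> F"
  shows "length \<alpha> \<le> length \<gamma>"
proof (rule ccontr)
  assume "\<not> length \<alpha> \<le> length \<gamma>"
  moreover from this eq have "\<gamma> = take (length \<gamma>) \<alpha>"
    by (simp add: append_eq_append_conv_if split: if_splits)
  ultimately have "\<gamma> = take (length \<gamma>) (butlast \<alpha>)"
    by (metis leI less_le_trans linorder_not_less nat_less_le take_butlast)
  then have "\<gamma> @ drop (length \<gamma>) (butlast \<alpha>) = butlast \<alpha>"
    by (metis append_take_drop_id)
  moreover have "butlast \<alpha> \<in> F"
    using \<alpha> by (simp add: minimal_nonmembers_def)
  ultimately have "\<gamma> \<in> F"
    using prefix by metis
  with \<open>\<gamma> \<notin> F\<close> show False ..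
qed

lemma inj_on_append_minimal_nonmembers:
  assumes prefix: "\<And>u v. u @ v \<in> F \<Longrightarrow> u \<in> F"
  shows "inj_on (\<lambda>(u, v). u @ v) (minimal_nonmembers A F \<times> Y)"
proof (clarsimp simp: inj_on_def)
  fix u v u' v'
  assume u: "u \<in> minimal_nonmembers A F" and u': "u' \<in> minimal_nonmembers A F"
    and eq: "u @ v = u' @ v'"
  have "u \<notin> F" "u' \<notin> F"
    using u u' by (auto simp: minimal_nonmembers_def)
  then have "length u = length u'"
    using minimal_nonmember_length_le[OF u _ eq]
      minimal_nonmember_length_le[OF u' _ eq[symmetric]]
      prefix by (metis le_antisym)
  with eq show "u = u' \<and> v = v'"
    by simp
qed

lemma minimal_nonmember_prefix:
  assumes "\<sigma> \<in> lists A" and "\<sigma> \<notin> F" and "[] \<in> F"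
  obtains \<alpha> \<beta> where "\<sigma> = \<alpha> @ \<beta>" and "\<alpha> \<in> minimal_nonmembers A F"
proof -
  define n where "n = (LEAST n. take n \<sigma> \<notin> F)"
  have n: "take n \<sigma> \<notin> F"
    unfolding n_def by (rule LeastI[of _ "length \<sigma>"]) (use assms in simp)
  have less: "take k \<sigma> \<in> F" if "k < n" for k
    using not_less_Least that unfolding n_def by blast
  have "n \<noteq> 0"
    using n assms(3) by (cases n) auto
  have "n \<le> length \<sigma>"
    using less[of "length \<sigma>"] assms(2) by fastforce
  then have "butlast (take n \<sigma>) = take (n - 1) \<sigma>"
    by (simp add: butlast_take)
  then have "take n \<sigma> \<in> minimal_nonmembers A F"
    using less[of "n - 1"] \<open>n \<noteq> 0\<close> n assms
    by (auto simp: minimal_nonmembers_def dest: in_set_takeD)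
  then show thesis
    by (intro that[of "take n \<sigma>" "drop n \<sigma>"]) simp_all
qed

section \<open>Occurrences of multi-patterns\<close>

lemma occurrence_append_append:
  assumes "occurrence \<rho> \<sigma> is"
  shows "occurrence \<rho> (\<gamma> @ \<sigma> @ \<delta>) (map ((+) (length \<gamma>)) is)"
proof -
  have len: "length is = length (pop_word \<rho>)" and lt: "set is \<subseteq> {..<length \<sigma>}"
    using assms by (auto simp: occurrence_def Let_def)
  have "(\<gamma> @ \<sigma> @ \<delta>) ! (map ((+) (length \<gamma>)) is ! p) = \<sigma> ! (is ! p)"
    if "p < length (pop_word \<rho>)" for p
    using that len subsetD[OF lt, of "is ! p"] by (simp add: nth_append)
  moreover have "set (map ((+) (length \<gamma>)) is) \<subseteq> {..<length (\<gamma> @ \<sigma> @ \<delta>)}"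
    using lt by auto
  moreover have "sorted_wrt (<) (map ((+) (length \<gamma>)) is)"
    using assms by (simp add: occurrence_def Let_def sorted_wrt_map)
  moreover have "map ((+) (length \<gamma>)) is ! Suc p = map ((+) (length \<gamma>)) is ! p + 1"
    if "Suc p < length (pop_word \<rho>)" and "p \<notin> pop_dashes \<rho>" for p
  proof -
    have "is ! Suc p = is ! p + 1"
      using assms that unfolding occurrence_def Let_def by blast
    with that len show ?thesis
      by simp
  qed
  ultimately show ?thesis
    using assms unfolding occurrence_def Let_def length_map by metis
qed

lemma avoids_append_append: "avoids (\<gamma> @ \<sigma> @ \<delta>) \<rho> \<Longrightarrow> avoids \<sigma> \<rho>"
  unfolding avoids_def using occurrence_append_append by blast

lemma avoids_prefix: "avoids (u @ v) \<rho> \<Longrightarrow> avoids u \<rho>"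
  using avoids_append_append[of "[]" u v] by simp

lemma avoids_suffix: "avoids (u @ v) \<rho> \<Longrightarrow> avoids v \<rho>"
  using avoids_append_append[of u v "[]"] by simp

lemma multi_word_Cons:
  "multi_word (w # \<tau>) = map (Pair 0) w @ map (apfst Suc) (multi_word \<tau>)"
proof -
  have "[0..<length (w # \<tau>)] = 0 # map Suc [0..<length \<tau>]"
    by (simp add: map_Suc_upt upt_conv_Cons del: upt_Suc)
  then show ?thesis
    unfolding multi_word_def by (simp add: map_concat o_def del: upt_Suc)
qed

lemma all_less_add_iff:
  "(\<forall>p<k + l. P p) \<longleftrightarrow> (\<forall>p<k. P p) \<and> (\<forall>p<l. P (k + p))" for k l :: nat
  by (metis add_less_cancel_left le_iff_add linorder_not_less trans_less_add1)

lemma all_pairs_less_add_iff: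
  fixes k l :: nat
  assumes "\<And>p q. p < k \<Longrightarrow> q < k \<Longrightarrow> P p q \<longleftrightarrow> Q p q"
    and "\<And>p q. p < l \<Longrightarrow> q < l \<Longrightarrow> P (k + p) (k + q) \<longleftrightarrow> R p q"
    and "\<And>p q. p < k \<Longrightarrow> q < l \<Longrightarrow> P p (k + q)"
    and "\<And>p q. p < l \<Longrightarrow> q < k \<Longrightarrow> P (k + p) q"
  shows "(\<forall>p<k + l. \<forall>q<k + l. P p q) \<longleftrightarrow> (\<forall>p<k. \<forall>q<k. Q p q) \<and> (\<forall>p<l. \<forall>q<l. R p q)"
  unfolding all_less_add_iff using assms by blast

text \<open>
  Every condition in the definition of an occurrence speaks of one or two positions of the
  pattern. If both lie in the first block, or both after it, it is a condition on one of the two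
  halves; if they lie on different sides, the letters are unequal and incomparable and the
  boundary is dashed, so nothing is required.
\<close>

lemma occurrence_multi_pop_Cons:
  assumes "length is = length w" and "set is \<subseteq> {..<length \<alpha>}"
  shows "occurrence (multi_pop (w # \<tau>)) (\<alpha> @ \<beta>) (is @ map ((+) (length \<alpha>)) js) \<longleftrightarrow>
    occurrence (consecutive_pop w) \<alpha> is \<and> occurrence (multi_pop \<tau>) \<beta> js"
    (is "?lhs \<longleftrightarrow> ?rhs")
proof (cases "length js = length (multi_word \<tau>)")
  case False
  then show ?thesis
    using assms by (auto simp: occurrence_def Let_def multi_pop_def multi_word_Cons)
next
  case True
  let ?k = "length w" and ?l = "length (multi_word \<tau>)"
  let ?W = "multi_word (w # \<tau>)" and ?V = "multi_word \<tau>"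
  let ?is = "is @ map ((+) (length \<alpha>)) js"
  have W1: "?W ! p = (0, w ! p)" if "p < ?k" for p
    using that by (simp add: multi_word_Cons nth_append)
  have W2: "?W ! (?k + p) = (Suc (fst (?V ! p)), snd (?V ! p))" if "p < ?l" for p
    using that by (simp add: multi_word_Cons nth_append apfst_def map_prod_def split_def)
  have lW: "length ?W = ?k + ?l"
    by (simp add: multi_word_Cons)
  have I1: "?is ! p = is ! p" if "p < ?k" for p
    using that assms by (simp add: nth_append)
  have I2: "?is ! (?k + p) = length \<alpha> + js ! p" if "p < ?l" for p
    using that assms True by (simp add: nth_append)
  have S1: "(\<alpha> @ \<beta>) ! (?is ! p) = \<alpha> ! (is ! p)" if "p < ?k" for p
    using that assms(1) subsetD[OF assms(2), of "is ! p"] I1 by (simp add: nth_append)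
  have S2: "(\<alpha> @ \<beta>) ! (?is ! (?k + p)) = \<beta> ! (js ! p)" if "p < ?l" for p
    using that I2 by (simp add: nth_append)
  have sorted: "sorted_wrt (<) ?is \<longleftrightarrow> sorted_wrt (<) is \<and> sorted_wrt (<) js"
    using assms by (auto simp: sorted_wrt_append sorted_wrt_map)
  have set: "set ?is \<subseteq> {..<length (\<alpha> @ \<beta>)} \<longleftrightarrow> set js \<subseteq> {..<length \<beta>}"
    using assms by auto
  have adj: "(\<forall>p. Suc p < ?k + ?l \<and> p \<notin> pop_dashes (multi_pop (w # \<tau>)) \<longrightarrow> ?is ! Suc p = ?is ! p + 1)
     \<longleftrightarrow> (\<forall>p. Suc p < ?k \<longrightarrow> is ! Suc p = is ! p + 1) \<and>
         (\<forall>p. Suc p < ?l \<and> p \<notin> pop_dashes (multi_pop \<tau>) \<longrightarrow> js ! Suc p = js ! p + 1)"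
    (is "?L \<longleftrightarrow> ?A \<and> ?B")
  proof -
    have "?L \<longleftrightarrow> (\<forall>p<?k + ?l. Suc p < ?k + ?l \<and> fst (?W ! p) = fst (?W ! Suc p) \<longrightarrow> ?is ! Suc p = ?is ! p + 1)"
      by (auto simp: multi_pop_def lW)
    also have "\<dots> \<longleftrightarrow> (\<forall>p<?k. Suc p < ?k + ?l \<and> fst (?W ! p) = fst (?W ! Suc p) \<longrightarrow> ?is ! Suc p = ?is ! p + 1)
       \<and> (\<forall>p<?l. Suc (?k + p) < ?k + ?l \<and> fst (?W ! (?k + p)) = fst (?W ! Suc (?k + p))
           \<longrightarrow> ?is ! Suc (?k + p) = ?is ! (?k + p) + 1)"
      by (rule all_less_add_iff)
    also have "(\<forall>p<?k. Suc p < ?k + ?l \<and> fst (?W ! p) = fst (?W ! Suc p) \<longrightarrow> ?is ! Suc p = ?is ! p + 1) \<longleftrightarrow> ?A"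
    proof -
      have "(Suc p < ?k + ?l \<and> fst (?W ! p) = fst (?W ! Suc p) \<longrightarrow> ?is ! Suc p = ?is ! p + 1)
         \<longleftrightarrow> (Suc p < ?k \<longrightarrow> is ! Suc p = is ! p + 1)" if p: "p < ?k" for p
      proof (cases "Suc p < ?k")
        case True
        then show ?thesis
          using p W1[of p] W1[of "Suc p"] I1[of p] I1[of "Suc p"] by simp
      next
        case False
        \<comment> \<open>Position \<open>p\<close> ends the first block, so a dash follows it; the case in which no
          further block follows is excluded by the bound on \<open>Suc p\<close>.\<close>
        with p have [simp]: "Suc p = ?k + 0" by simp
        show ?thesis
          using p W1[of p] W2[of 0] by auto
      qed
      then show ?thesis
        using Suc_lessD by blast
    qed
    also have "(\<forall>p<?l. Suc (?k + p) < ?k + ?l \<and> fst (?W ! (?k + p)) = fst (?W ! Suc (?k + p))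
           \<longrightarrow> ?is ! Suc (?k + p) = ?is ! (?k + p) + 1) \<longleftrightarrow> ?B"
    proof -
      have "(Suc (?k + p) < ?k + ?l \<and> fst (?W ! (?k + p)) = fst (?W ! Suc (?k + p))
           \<longrightarrow> ?is ! Suc (?k + p) = ?is ! (?k + p) + 1)
        \<longleftrightarrow> (Suc p < ?l \<and> p \<notin> pop_dashes (multi_pop \<tau>) \<longrightarrow> js ! Suc p = js ! p + 1)" if p: "p < ?l" for p
        using p W2[of p] W2[of "Suc p"] I2[of p] I2[of "Suc p"]
        by (auto simp: multi_pop_def)
      then show ?thesis
        using Suc_lessD by blast
    qed
    finally show ?thesis .
  qed
  have eq: "(\<forall>p<?k + ?l. \<forall>q<?k + ?l. ?W ! p = ?W ! q \<longrightarrow> (\<alpha> @ \<beta>) ! (?is ! p) = (\<alpha> @ \<beta>) ! (?is ! q))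
    \<longleftrightarrow> (\<forall>p<?k. \<forall>q<?k. w ! p = w ! q \<longrightarrow> \<alpha> ! (is ! p) = \<alpha> ! (is ! q)) \<and>
        (\<forall>p<?l. \<forall>q<?l. ?V ! p = ?V ! q \<longrightarrow> \<beta> ! (js ! p) = \<beta> ! (js ! q))"
    by (rule all_pairs_less_add_iff) (simp_all add: W1 W2 S1 S2 prod_eq_iff)
  have less: "(\<forall>p<?k + ?l. \<forall>q<?k + ?l. multi_less (?W ! p) (?W ! q) \<longrightarrow> (\<alpha> @ \<beta>) ! (?is ! p) < (\<alpha> @ \<beta>) ! (?is ! q))
    \<longleftrightarrow> (\<forall>p<?k. \<forall>q<?k. w ! p < w ! q \<longrightarrow> \<alpha> ! (is ! p) < \<alpha> ! (is ! q)) \<and>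
        (\<forall>p<?l. \<forall>q<?l. multi_less (?V ! p) (?V ! q) \<longrightarrow> \<beta> ! (js ! p) < \<beta> ! (js ! q))"
    by (rule all_pairs_less_add_iff) (simp_all add: W1 W2 S1 S2 multi_less_def)
  have "?lhs \<longleftrightarrow> sorted_wrt (<) ?is \<and> set ?is \<subseteq> {..<length (\<alpha> @ \<beta>)} \<and>
      (\<forall>p. Suc p < ?k + ?l \<and> p \<notin> pop_dashes (multi_pop (w # \<tau>)) \<longrightarrow> ?is ! Suc p = ?is ! p + 1) \<and>
      (\<forall>p<?k + ?l. \<forall>q<?k + ?l. ?W ! p = ?W ! q \<longrightarrow> (\<alpha> @ \<beta>) ! (?is ! p) = (\<alpha> @ \<beta>) ! (?is ! q)) \<and>
      (\<forall>p<?k + ?l. \<forall>q<?k + ?l. multi_less (?W ! p) (?W ! q) \<longrightarrow> (\<alpha> @ \<beta>) ! (?is ! p) < (\<alpha> @ \<beta>) ! (?is ! q))"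
    using assms(1) True by (simp add: occurrence_def Let_def multi_pop_def lW)
  also have "\<dots> \<longleftrightarrow> ?rhs"
    unfolding sorted set adj eq less using assms True
    by (simp add: occurrence_def Let_def consecutive_pop_def, simp add: multi_pop_def, blast)
  finally show ?thesis .
qed

text \<open>
  Given an occurrence of the whole pattern, cut the word right after the position of the last
  letter of the first block: positions increase, so the remaining blocks occur after the cut.
  The first block must be nonempty for this cut to exist.
\<close>

lemma not_avoids_multi_pop_Cons:
  assumes "w \<noteq> []"
  shows "\<not> avoids \<sigma> (multi_pop (w # \<tau>)) \<longleftrightarrow>
    (\<exists>\<alpha> \<beta>. \<sigma> = \<alpha> @ \<beta> \<and> \<not> avoids \<alpha> (consecutive_pop w) \<and> \<not> avoids \<beta> (multi_pop \<tau>))"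
proof
  assume "\<not> avoids \<sigma> (multi_pop (w # \<tau>))"
  then obtain ks where ks: "occurrence (multi_pop (w # \<tau>)) \<sigma> ks"
    by (auto simp: avoids_def)
  have len: "length ks = length w + length (multi_word \<tau>)" and sorted: "sorted_wrt (<) ks"
    and lt: "set ks \<subseteq> {..<length \<sigma>}"
    using ks by (auto simp: occurrence_def Let_def multi_pop_def multi_word_Cons)
  define "is" where "is = take (length w) ks"
  define js where "js = drop (length w) ks"
  have split: "ks = is @ js" and len_is: "length is = length w"
    by (auto simp: is_def js_def len)
  have "is \<noteq> []"
    using len_is assms by auto
  define c where "c = Suc (last is)"
  have "c \<le> length \<sigma>"
    using subsetD[OF lt, of "last is"] split \<open>is \<noteq> []\<close> by (simp add: c_def Suc_le_eq)
  then have len_c: "length (take c \<sigma>) = c"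
    by simp
  have is_c: "set is \<subseteq> {..<c}"
  proof -
    have "sorted_wrt (<) (butlast is @ [last is])"
      using sorted split \<open>is \<noteq> []\<close> by (simp add: sorted_wrt_append)
    then have "\<forall>i\<in>set (butlast is). i < last is"
      by (simp add: sorted_wrt_append)
    moreover have "set is = insert (last is) (set (butlast is))"
      using \<open>is \<noteq> []\<close> by (metis append_butlast_last_id list.set(1) list.simps(15) rotate1.simps(2) set_rotate1)
    ultimately show ?thesis
      by (auto simp: c_def less_Suc_eq)
  qed
  have "c \<le> j" if "j \<in> set js" for j
    using sorted split that \<open>is \<noteq> []\<close> last_in_set[of "is"]
    by (auto simp: sorted_wrt_append c_def Suc_le_eq)
  then have js: "map ((+) c) (map (\<lambda>j. j - c) js) = js"
    by (auto intro!: map_idI)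
  have "occurrence (multi_pop (w # \<tau>)) (take c \<sigma> @ drop c \<sigma>)
      (is @ map ((+) (length (take c \<sigma>))) (map (\<lambda>j. j - c) js))"
    unfolding len_c js using ks split by simp
  then have "occurrence (consecutive_pop w) (take c \<sigma>) is \<and>
      occurrence (multi_pop \<tau>) (drop c \<sigma>) (map (\<lambda>j. j - c) js)"
    by (subst (asm) occurrence_multi_pop_Cons) (use len_is is_c len_c in simp_all)
  then show "\<exists>\<alpha> \<beta>. \<sigma> = \<alpha> @ \<beta> \<and> \<not> avoids \<alpha> (consecutive_pop w) \<and> \<not> avoids \<beta> (multi_pop \<tau>)"
    unfolding avoids_def by (metis append_take_drop_id)
next
  assume "\<exists>\<alpha> \<beta>. \<sigma> = \<alpha> @ \<beta> \<and> \<not> avoids \<alpha> (consecutive_pop w) \<and> \<not> avoids \<beta> (multi_pop \<tau>)"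
  then obtain \<alpha> \<beta> "is" js where \<sigma>: "\<sigma> = \<alpha> @ \<beta>"
    and occ: "occurrence (consecutive_pop w) \<alpha> is" "occurrence (multi_pop \<tau>) \<beta> js"
    by (auto simp: avoids_def)
  have "length is = length w" and "set is \<subseteq> {..<length \<alpha>}"
    using occ(1) unfolding occurrence_def Let_def consecutive_pop_def pop.sel by blast+
  then have "occurrence (multi_pop (w # \<tau>)) \<sigma> (is @ map ((+) (length \<alpha>)) js)"
    unfolding \<sigma> using occ by (simp add: occurrence_multi_pop_Cons)
  then show "\<not> avoids \<sigma> (multi_pop (w # \<tau>))"
    by (auto simp: avoids_def)
qed

text \<open>
  The empty pattern occurs in every word, so no word avoids it. The empty sum on the right-hand
  side of the formula is therefore correct without blocks, and the induction can start there.
\<close>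

lemma not_avoids_multi_pop_Nil: "\<not> avoids \<sigma> (multi_pop [])"
  by (auto simp: avoids_def occurrence_def multi_pop_def multi_word_def intro!: exI[of _ "[]"])

section \<open>Peeling off the first block\<close>

definition avoiders :: "nat set \<Rightarrow> 'l pop \<Rightarrow> nat list set" where
  "avoiders A \<rho> = {\<sigma> \<in> lists A. avoids \<sigma> \<rho>}"

lemma comp_gf_eq_word_gf: "comp_gf A \<rho> = word_gf (avoiders A \<rho>)"
proof -
  have "avoiding_compositions A \<rho> n m = avoiders A \<rho> \<inter> {\<sigma>. length \<sigma> = m \<and> sum_list \<sigma> = n}" for n m
    by (auto simp: avoiding_compositions_def compositions_def avoiders_def)
  then show ?thesis
    by (simp add: comp_gf_def word_gf_def)
qed

lemma avoiders_prefix: "u @ v \<in> avoiders A \<rho> \<Longrightarrow> u \<in> avoiders A \<rho>"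
  by (auto simp: avoiders_def intro: avoids_prefix)

lemma Nil_in_avoiders: "w \<noteq> [] \<Longrightarrow> [] \<in> avoiders A (consecutive_pop w)"
  by (auto simp: avoiders_def avoids_def occurrence_def Let_def consecutive_pop_def)

text \<open>
  The factor \<open>u\<close> is the shortest prefix that contains the first block. Any other split
  \<open>\<gamma>\<delta>\<close> with the first block in \<open>\<gamma>\<close> has \<open>\<gamma>\<close> at least as long as \<open>u\<close>, so \<open>\<delta>\<close> is a suffix of \<open>v\<close>;
  it thus suffices that \<open>v\<close> avoids the remaining blocks.
\<close>

lemma avoiders_multi_pop_Cons:
  fixes A w
  assumes w: "w \<noteq> []"
  defines "F \<equiv> avoiders A (consecutive_pop w)"
  shows "avoiders A (multi_pop (w # \<tau>)) =
    F \<union> (\<lambda>(u, v). u @ v) ` (minimal_nonmembers A F \<times> avoiders A (multi_pop \<tau>))"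
    (is "?L = F \<union> ?R")
proof (intro equalityI subsetI)
  fix \<sigma> assume \<sigma>: "\<sigma> \<in> ?L"
  show "\<sigma> \<in> F \<union> ?R"
  proof (cases "\<sigma> \<in> F")
    case False
    have "\<sigma> \<in> lists A"
      using \<sigma> by (simp add: avoiders_def)
    then obtain \<alpha> \<beta> where \<sigma>_eq: "\<sigma> = \<alpha> @ \<beta>" and \<alpha>: "\<alpha> \<in> minimal_nonmembers A F"
      using minimal_nonmember_prefix False Nil_in_avoiders[OF w] unfolding F_def by metis
    then have "\<not> avoids \<alpha> (consecutive_pop w)"
      by (auto simp: minimal_nonmembers_def F_def avoiders_def)
    then have "avoids \<beta> (multi_pop \<tau>)"
      using \<sigma> \<sigma>_eq not_avoids_multi_pop_Cons[OF w, of \<sigma> \<tau>] by (auto simp: avoiders_def)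
    then have "\<beta> \<in> avoiders A (multi_pop \<tau>)"
      using \<open>\<sigma> \<in> lists A\<close> \<sigma>_eq by (auto simp: avoiders_def)
    with \<sigma>_eq \<alpha> show ?thesis
      by auto
  qed simp
next
  fix \<sigma> assume "\<sigma> \<in> F \<union> ?R"
  then consider "\<sigma> \<in> F" | \<alpha> \<beta> where "\<sigma> = \<alpha> @ \<beta>" "\<alpha> \<in> minimal_nonmembers A F"
    "\<beta> \<in> avoiders A (multi_pop \<tau>)"
    by auto
  then show "\<sigma> \<in> ?L"
  proof cases
    case 1
    then show ?thesis
      using not_avoids_multi_pop_Cons[OF w, of \<sigma> \<tau>]
      by (auto simp: F_def avoiders_def dest: avoids_prefix)
  next
    case (2 \<alpha> \<beta>)
    have "\<sigma> \<in> lists A"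
      using 2 by (auto simp: minimal_nonmembers_def avoiders_def)
    moreover have "avoids \<sigma> (multi_pop (w # \<tau>))"
    proof (rule ccontr)
      assume "\<not> avoids \<sigma> (multi_pop (w # \<tau>))"
      then obtain \<gamma> \<delta> where \<gamma>\<delta>: "\<sigma> = \<gamma> @ \<delta>" "\<not> avoids \<gamma> (consecutive_pop w)"
        "\<not> avoids \<delta> (multi_pop \<tau>)"
        using not_avoids_multi_pop_Cons[OF w] by blast
      have eq: "\<alpha> @ \<beta> = \<gamma> @ \<delta>"
        using 2 \<gamma>\<delta> by simp
      have "\<gamma> \<notin> F"
        using \<gamma>\<delta> by (simp add: F_def avoiders_def)
      then have "length \<alpha> \<le> length \<gamma>"
        by (rule minimal_nonmember_length_le[OF 2(2) _ eq])
          (auto simp: F_def intro: avoiders_prefix)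
      with eq obtain \<kappa> where "\<beta> = \<kappa> @ \<delta>"
        by (auto simp: append_eq_append_conv2)
      then show False
        using 2 \<gamma>\<delta> by (auto simp: avoiders_def dest: avoids_suffix)
    qed
    ultimately show ?thesis
      by (simp add: avoiders_def)
  qed
qed

lemma comp_gf_multi_pop_Cons:
  assumes fin: "finite A" and w: "w \<noteq> []"
  shows "comp_gf A (multi_pop (w # \<tau>)) = comp_gf A (consecutive_pop w) +
    ((gf_y * (\<Sum>a\<in>A. gf_x ^ a) - 1) * comp_gf A (consecutive_pop w) + 1) * comp_gf A (multi_pop \<tau>)"
proof -
  let ?F = "avoiders A (consecutive_pop w)" and ?G = "avoiders A (multi_pop \<tau>)"
  let ?M = "minimal_nonmembers A ?F"
  have F: "?F \<subseteq> lists A" and G: "?G \<subseteq> lists A" and M: "?M \<subseteq> lists A"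
    by (auto simp: avoiders_def minimal_nonmembers_def)
  have "?F \<inter> (\<lambda>(u, v). u @ v) ` (?M \<times> ?G) = {}"
    using avoiders_prefix by (fastforce simp: minimal_nonmembers_def)
  then have "comp_gf A (multi_pop (w # \<tau>)) = word_gf ?F + word_gf ((\<lambda>(u, v). u @ v) ` (?M \<times> ?G))"
    unfolding comp_gf_eq_word_gf avoiders_multi_pop_Cons[OF w]
    by (intro word_gf_Un[OF fin F]) (auto simp: avoiders_def minimal_nonmembers_def)
  also have "word_gf ((\<lambda>(u, v). u @ v) ` (?M \<times> ?G)) = word_gf ?M * word_gf ?G"
    by (intro word_gf_append[OF fin M G] inj_on_append_minimal_nonmembers) (rule avoiders_prefix)
  also have "word_gf ?M = (gf_y * (\<Sum>a\<in>A. gf_x ^ a) - 1) * word_gf ?F + 1"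
    by (intro word_gf_minimal_nonmembers[OF fin F] Nil_in_avoiders w) (rule avoiders_prefix)
  finally show ?thesis
    by (simp only: comp_gf_eq_word_gf)
qed

theorem theorem3p7:
  fixes A :: "nat set" and \<tau> :: "nat list list"
  assumes "finite A" and "\<forall>a\<in>A. 0 < a"
    and "is_multi_pattern \<tau>"
  shows "comp_gf A (multi_pop \<tau>) =
    (\<Sum>j<length \<tau>. comp_gf A (consecutive_pop (\<tau> ! j)) *
      (\<Prod>i<j. (gf_y * (\<Sum>a\<in>A. gf_x ^ a) - 1) * comp_gf A (consecutive_pop (\<tau> ! i)) + 1))"
proof -
  have "\<forall>w\<in>set \<tau>. w \<noteq> []"
    using assms(3) by (auto simp: is_multi_pattern_def is_consecutive_pattern_def)
  then show ?thesis
  proof (induction \<tau>)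
    case Nil
    have "avoiders A (multi_pop []) = {}"
      by (simp add: avoiders_def not_avoids_multi_pop_Nil)
    then show ?case
      by (simp add: comp_gf_eq_word_gf fps_eq_iff word_gf_nth)
  next
    case (Cons w \<tau>)
    then show ?case
      by (simp add: comp_gf_multi_pop_Cons[OF assms(1)] sum.lessThan_Suc_shift
          prod.lessThan_Suc_shift sum_distrib_left mult_ac del: sum.lessThan_Suc prod.lessThan_Suc)
  qed
qed

end
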